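(* There are infinitely many Gaussian primes.
   Context: A Gaussian prime is a prime element of the ring $\mathbb{Z}[i]$ of Gaussian integers. *)

theory Defs
  imports "HOL-Computational_Algebra.Factorial_Ring" Complex_Main
begin

definition Gauss_ints :: "complex set" where
  "Gauss_ints = {of_int a + of_int b * \<i> | a b. True}"

lemma Gauss_intsI: "z = of_int a + of_int b * \<i> \<Longrightarrow> z \<in> Gauss_ints"
  by (auto simp: Gauss_ints_def)

lemma Gauss_intsE:
  assumes "z \<in> Gauss_ints"
  obtains a b :: int where "z = of_int a + of_int b * \<i>"
  using assms by (auto simp: Gauss_ints_def)

typedef gauss_int = Gauss_ints
  morphisms complex_of_gauss_int Abs_gauss_int
  by (rule exI, rule Gauss_intsI, rule refl)

setup_lifting type_definition_gauss_int

instantiation gauss_int :: idom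
begin

lift_definition zero_gauss_int :: gauss_int is 0
  by (rule Gauss_intsI[of _ 0 0]) simp

lift_definition one_gauss_int :: gauss_int is 1
  by (rule Gauss_intsI[of _ 1 0]) simp

lift_definition plus_gauss_int :: "gauss_int \<Rightarrow> gauss_int \<Rightarrow> gauss_int" is "(+)"
proof (elim Gauss_intsE)
  fix x y :: complex and a b c d :: int
  assume "x = of_int a + of_int b * \<i>" "y = of_int c + of_int d * \<i>"
  then show "x + y \<in> Gauss_ints"
    by (intro Gauss_intsI[of _ "a + c" "b + d"]) (simp add: algebra_simps)
qed

lift_definition uminus_gauss_int :: "gauss_int \<Rightarrow> gauss_int" is uminus
proof (elim Gauss_intsE)
  fix x :: complex and a b :: int
  assume "x = of_int a + of_int b * \<i>"
  then show "- x \<in> Gauss_ints"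
    by (intro Gauss_intsI[of _ "- a" "- b"]) simp
qed

lift_definition minus_gauss_int :: "gauss_int \<Rightarrow> gauss_int \<Rightarrow> gauss_int" is "(-)"
proof (elim Gauss_intsE)
  fix x y :: complex and a b c d :: int
  assume "x = of_int a + of_int b * \<i>" "y = of_int c + of_int d * \<i>"
  then show "x - y \<in> Gauss_ints"
    by (intro Gauss_intsI[of _ "a - c" "b - d"]) (simp add: algebra_simps)
qed

lift_definition times_gauss_int :: "gauss_int \<Rightarrow> gauss_int \<Rightarrow> gauss_int" is "(*)"
proof (elim Gauss_intsE)
  fix x y :: complex and a b c d :: int
  assume "x = of_int a + of_int b * \<i>" "y = of_int c + of_int d * \<i>"
  then show "x * y \<in> Gauss_ints"
    by (intro Gauss_intsI[of _ "a * c - b * d" "a * d + b * c"])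
       (simp add: complex_eq_iff)
qed

instance
  by standard (transfer; simp add: algebra_simps)+

end

end

theory Submission
  imports Defs "HOL-Number_Theory.Residues"
begin

text \<open>
  A rational prime \<open>p\<close> with \<open>p mod 4 = 3\<close> stays prime in the Gaussian integers, and there are
  infinitely many such \<open>p\<close>.

  Euclid's argument gives the infinitude: \<open>4 * n! - 1\<close> is congruent to \<open>3\<close> modulo \<open>4\<close>, so one of
  its prime factors is too (products of numbers congruent to \<open>1\<close> are congruent to \<open>1\<close>), and no
  prime factor of it is at most \<open>n\<close>.

  For the primality, let \<open>p\<close> divide \<open>z * w\<close>. Then \<open>p\<close> divides the norm of \<open>z * w\<close>, which is the
  product of the norms, hence it divides one of them, say \<open>a\<^sup>2 + b\<^sup>2\<close> where \<open>z = a + b\<i>\<close>. Since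
  \<open>-1\<close> is not a square modulo \<open>p\<close> (lemma \<open>prime_3_mod_4_dvd_sum_squares\<close>), \<open>p\<close> divides both \<open>a\<close> and
  \<open>b\<close>, and so divides \<open>z\<close>.
\<close>

text \<open>
  An odd number all of whose prime factors are congruent to \<open>1\<close> modulo \<open>4\<close> is itself congruent to
  \<open>1\<close>. In the induction, one of two factors of \<open>m\<close> must again be congruent to \<open>3\<close>, as no other pair
  of residues has product \<open>3\<close> modulo \<open>4\<close>.
\<close>
lemma prime_factor_3_mod_4:
  fixes m :: nat
  assumes "m mod 4 = 3"
  shows "\<exists>p. prime p \<and> p dvd m \<and> p mod 4 = 3"
  using assms
proof (induction m rule: less_induct)
  case (less m)
  show ?case
  proof (cases "prime m")
    case True
    with less.prems show ?thesis by auto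
  next
    case False
    from less.prems have "m > 1" by (cases "m = 0 \<or> m = 1") auto
    with False obtain a where a: "a dvd m" "a \<noteq> 1" "a \<noteq> m"
      by (auto simp: prime_nat_iff)
    then obtain b where b: "m = a * b" by auto
    have "a < m" using a(1,3) \<open>m > 1\<close> by (simp add: dvd_imp_le le_neq_implies_less)
    have "b < m" using a(2) b \<open>m > 1\<close> by (cases "a = 0 \<or> b = 0") auto
    have "(a mod 4) * (b mod 4) mod 4 = 3"
      using less.prems b by (simp add: mod_mult_eq)
    moreover have "x = 3 \<or> y = 3" if "x * y mod 4 = 3" "x < 4" "y < 4" for x y :: nat
    proof -
      have "x \<in> {0, 1, 2, 3}" "y \<in> {0, 1, 2, 3}" using that(2,3) by auto
      then show ?thesis using that(1) by auto
    qed
    ultimately have "a mod 4 = 3 \<or> b mod 4 = 3" by simp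
    then obtain c where "c < m" "c dvd m" "c mod 4 = 3"
      using \<open>a < m\<close> \<open>b < m\<close> b by (metis dvd_triv_left dvd_triv_right)
    then show ?thesis
      using less.IH by (blast intro: dvd_trans)
  qed
qed

lemma infinite_primes_3_mod_4: "infinite {p :: nat. prime p \<and> p mod 4 = 3}"
  unfolding infinite_nat_iff_unbounded
proof
  fix n :: nat
  define m :: nat where "m = 4 * fact n - 1"
  have m: "m + 1 = 4 * fact n" by (simp add: m_def)
  then have "m mod 4 = 3" by presburger
  then obtain p where p: "prime p" "p dvd m" "p mod 4 = 3"
    using prime_factor_3_mod_4 by blast
  have "\<not> p \<le> n"
  proof
    assume "p \<le> n"
    then have "p dvd fact n" using p(1) by (simp add: prime_dvd_fact_iff)
    then have "p dvd m + 1" unfolding m by simp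
    then have "p dvd 1" using p(2) dvd_add_right_iff by blast
    with p(1) show False by simp
  qed
  then have "n < p" by simp
  with p show "\<exists>p>n. p \<in> {p. prime p \<and> p mod 4 = 3}" by blast
qed

lemma fermat_theorem_int:
  fixes a :: int
  assumes "prime p" "\<not> int p dvd a"
  shows "[a ^ (p - 1) = 1] (mod int p)"
proof -
  have "prime (int p)" using assms(1) by simp
  then have "coprime a (int p)"
    using assms(2) prime_imp_coprime coprime_commute by blast
  moreover have "residues (int p)"
    using prime_gt_1_nat[OF assms(1)] by (simp add: residues_def)
  ultimately have "[a ^ totient (nat (int p)) = 1] (mod int p)"
    using residues.euler_theorem by blast
  then show ?thesis using assms(1) by (simp add: totient_prime)
qed

text \<open>
  If \<open>a\<^sup>2 = -b\<^sup>2\<close> modulo \<open>p = 4k + 3\<close>, raise both sides to the odd power \<open>2k + 1 = (p - 1) / 2\<close>. When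
  \<open>p\<close> divides neither number, Fermat's theorem turns this into \<open>1 = -1\<close> modulo an odd prime.
\<close>
lemma prime_3_mod_4_dvd_sum_squares:
  fixes a b :: int
  assumes p: "prime p" "p mod 4 = 3" and dvd: "int p dvd a\<^sup>2 + b\<^sup>2"
  shows "int p dvd a \<and> int p dvd b"
proof (rule ccontr)
  assume contra: "\<not> ?thesis"
  have prime: "prime (int p)" using p(1) by simp
  have "int p dvd a\<^sup>2 \<longleftrightarrow> int p dvd b\<^sup>2"
    using dvd dvd_add_left_iff dvd_add_right_iff by blast
  then have "int p dvd a \<longleftrightarrow> int p dvd b"
    by (simp add: prime_dvd_power_iff[OF prime])
  with contra have nd: "\<not> int p dvd a" "\<not> int p dvd b" by auto
  \<comment> \<open>\<open>p mod 4 = 3\<close> makes \<open>h\<close> odd, so the sign in \<open>- (b\<^sup>2)\<close> survives the power \<open>h\<close>.\<close>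
  obtain h where h: "p - 1 = 2 * h" "odd h"
  proof
    obtain q where "p = 4 * q + 3" using p(2) by (metis mult_div_mod_eq)
    then show "p - 1 = 2 * (2 * (p div 4) + 1)" by simp
  qed simp
  have "[a\<^sup>2 = - (b\<^sup>2)] (mod int p)"
    using dvd by (simp add: cong_iff_dvd_diff)
  then have "[(a\<^sup>2) ^ h = (- (b\<^sup>2)) ^ h] (mod int p)"
    by (rule cong_pow)
  then have "[a ^ (p - 1) = - (b ^ (p - 1))] (mod int p)"
    using h by (simp add: power_mult)
  moreover have "[- (b ^ (p - 1)) = -1] (mod int p)"
    using fermat_theorem_int[OF p(1) nd(2)] by (simp add: cong_minus_minus_iff)
  ultimately have "[1 = - 1] (mod int p)"
    using fermat_theorem_int[OF p(1) nd(1)] by (meson cong_sym cong_trans)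
  then have "int p dvd 2" by (simp add: cong_iff_dvd_diff)
  then have "p \<le> 2" using zdvd_imp_le by force
  moreover have "3 \<le> p" using mod_less_eq_dividend[of p 4] p(2) by simp
  ultimately show False by simp
qed

lift_definition Gauss :: "int \<Rightarrow> int \<Rightarrow> gauss_int" is "\<lambda>a b. of_int a + of_int b * \<i>"
  by (rule Gauss_intsI, rule refl)

lemma Gauss_cases: obtains a b where "z = Gauss a b"
  by (metis Gauss.rep_eq Gauss_intsE complex_of_gauss_int complex_of_gauss_int_inject)

lemma Gauss_eq_iff: "Gauss a b = Gauss c d \<longleftrightarrow> a = c \<and> b = d"
  by transfer (simp add: complex_eq_iff)

lemma Gauss_add: "Gauss a b + Gauss c d = Gauss (a + c) (b + d)"
  by transfer (simp add: complex_eq_iff)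

lemma Gauss_mult: "Gauss a b * Gauss c d = Gauss (a * c - b * d) (a * d + b * c)"
  by transfer (simp add: complex_eq_iff)

lemma zero_eq_Gauss: "0 = Gauss 0 0"
  by transfer simp

lemma one_eq_Gauss: "1 = Gauss 1 0"
  by transfer simp

lemma of_nat_eq_Gauss: "of_nat n = Gauss (int n) 0"
  by (induction n) (simp_all add: zero_eq_Gauss one_eq_Gauss Gauss_add)

lemma of_nat_dvd_Gauss_iff:
  "of_nat n dvd Gauss a b \<longleftrightarrow> int n dvd a \<and> int n dvd b"
proof
  assume "of_nat n dvd Gauss a b"
  then obtain w where w: "Gauss a b = of_nat n * w" by (elim dvdE)
  obtain c d where "w = Gauss c d" by (rule Gauss_cases)
  with w show "int n dvd a \<and> int n dvd b"
    by (simp add: of_nat_eq_Gauss Gauss_mult Gauss_eq_iff)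
next
  assume "int n dvd a \<and> int n dvd b"
  then obtain c d where "a = int n * c" "b = int n * d" by (meson dvdE)
  then have "Gauss a b = of_nat n * Gauss c d"
    by (simp add: of_nat_eq_Gauss Gauss_mult)
  then show "of_nat n dvd Gauss a b" by simp
qed

text \<open>
  The step from \<open>p\<close> dividing a product to \<open>p\<close> dividing a factor is taken on norms, where it is the
  primality of \<open>p\<close> in the rational integers; a norm being a sum of
  two squares, its divisibility by \<open>p\<close> carries back to both coordinates of the factor.
\<close>
lemma prime_elem_gauss_int_of_nat:
  assumes p: "prime p" "p mod 4 = 3"
  shows "prime_elem (of_nat p :: gauss_int)"
proof (rule prime_elemI)
  show "(of_nat p :: gauss_int) \<noteq> 0"
    using p(1) by (auto simp: of_nat_eq_Gauss zero_eq_Gauss Gauss_eq_iff)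
  show "\<not> (of_nat p :: gauss_int) dvd 1"
    using p(1) by (auto simp: one_eq_Gauss of_nat_dvd_Gauss_iff)
next
  fix z w :: gauss_int
  assume dvd: "of_nat p dvd z * w"
  obtain a b where z: "z = Gauss a b" by (rule Gauss_cases)
  obtain c d where w: "w = Gauss c d" by (rule Gauss_cases)
  have "int p dvd a * c - b * d" "int p dvd a * d + b * c"
    using dvd by (simp_all add: z w Gauss_mult of_nat_dvd_Gauss_iff)
  then have "int p dvd (a * c - b * d)\<^sup>2 + (a * d + b * c)\<^sup>2"
    by (simp add: power2_eq_square)
  also have "\<dots> = (a\<^sup>2 + b\<^sup>2) * (c\<^sup>2 + d\<^sup>2)"
    by (simp add: power2_eq_square algebra_simps)
  finally have "int p dvd a\<^sup>2 + b\<^sup>2 \<or> int p dvd c\<^sup>2 + d\<^sup>2"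
    using p(1) by (simp add: prime_dvd_mult_iff)
  then show "of_nat p dvd z \<or> of_nat p dvd w"
    unfolding z w of_nat_dvd_Gauss_iff using prime_3_mod_4_dvd_sum_squares[OF p] by blast
qed

theorem corollary5p2:
  "infinite {p :: gauss_int. prime_elem p}"
proof -
  have "inj (of_nat :: nat \<Rightarrow> gauss_int)"
    by (rule injI) (simp add: of_nat_eq_Gauss Gauss_eq_iff)
  then have "infinite ((of_nat :: nat \<Rightarrow> gauss_int) ` {p. prime p \<and> p mod 4 = 3})"
    using infinite_primes_3_mod_4 by (meson finite_imageD inj_on_subset subset_UNIV)
  moreover have "of_nat ` {p :: nat. prime p \<and> p mod 4 = 3} \<subseteq> {p :: gauss_int. prime_elem p}"
    using prime_elem_gauss_int_of_nat by auto
  ultimately show ?thesis by (rule infinite_super[rotated])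
qed

end
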